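(* Let $G$ be a finite abelian group with chain $1\subset G$. The glider characters $\{\chi_A: A\subset G\}$, indexed by all subsets $A$ of $G$ (including the empty set), are $\mathbb{C}$-linearly independent in $\mathbb{C}\otimes_{\mathbb{Z}}R(\widetilde G)$.
   Context: Gliders are taken over $\mathbb{C}$ for the filtration $F_0=\mathbb{C}$, $F_n=\mathbb{C}G$ ($n\ge1$). An irreducible glider of essential length $1$ and zero body is given by a finite-dimensional $\mathbb{C}G$-module $M$ and a line $M_1=\mathbb{C}m$ with $m\neq 0$ and $M=\mathbb{C}Gm$, written $M\supset\mathbb{C}m\supset0\supset\cdots$. The irreducible glider of essential length $0$ and zero body is $\mathbb{C}\supset0\supset\cdots$. An isomorphism of gliders $M\supset M_1$ and $N\supset N_1$ of essential length $1$ is a $\mathbb{C}G$-isomorphism $M\to N$ mapping $M_1$ onto $N_1$. Fix an isomorphism of $G$ with its character group and let $T_g$ be the one-dimensional representation corresponding to $g\in G$. For nonempty $A\subset G$ let $\chi_A$ be the generalized character of the irreducible glider $\bigoplus_{g\in A}T_g\supset\mathbb{C}\big(\sum_{g\in A}t_g\big)\supset0\supset\cdots$ with $0\ne t_g\in T_g$ (its isomorphism class does not depend on the $t_g$); $\chi_\emptyset$ is the generalized character of $\mathbb{C}\supset0\supset\cdots$. The generalized character of an irreducible glider $M$ consists of its generalized trace map together with the datum of the one-dimensional space $M_1$, so that non-isomorphic irreducible gliders have different generalized characters. $R(\widetilde G)$ is the free $\mathbb{Z}$-module generated by the generalized characters $\chi_M$, with $M$ running over the isomorphism classes of irreducible gliders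 of essential length $\le 1$ and zero body. *)

theory Defs
  imports "Jordan_Normal_Form.VS_Connect" "HOL-Algebra.Free_Abelian_Groups"
begin

text \<open>
  Throughout, \<open>G\<close> is a finite group with the chain \<open>1 \<subset> G\<close>, and gliders are taken with respect to
  the filtration \<open>F\<^sub>0 = \<complex>\<close>, \<open>F\<^sub>n = \<complex>G\<close> (\<open>n \<ge> 1\<close>).
\<close>

section \<open>Characters of a group\<close>

definition complex_units :: "complex monoid" where
  "complex_units = \<lparr>carrier = - {0}, monoid.mult = (*), one = 1\<rparr>"

text \<open>Characters are made extensional, so that equality is equality on \<open>carrier G\<close>.\<close>

definition character_group :: "('a, 'b) monoid_scheme \<Rightarrow> ('a \<Rightarrow> complex) monoid" where
  "character_group G =
    \<lparr>carrier = hom G complex_units \<inter> extensional (carrier G),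
     monoid.mult = (\<lambda>\<chi> \<psi>. \<lambda>g\<in>carrier G. \<chi> g * \<psi> g),
     one = (\<lambda>g\<in>carrier G. 1)\<rparr>"


section \<open>Irreducible gliders of essential length at most 1 and zero body\<close>

text \<open>
  A finite-dimensional \<open>\<complex>G\<close>-module is given by a matrix representation \<open>\<rho>\<close> on \<open>\<complex>\<^sup>n\<close>; every
  finite-dimensional module is isomorphic to one of this form, so the isomorphism classes below
  are all isomorphism classes, while their collection is a set.
\<close>

definition matrix_rep :: "('a, 'b) monoid_scheme \<Rightarrow> nat \<Rightarrow> ('a \<Rightarrow> complex mat) \<Rightarrow> bool" where
  "matrix_rep G n \<rho> \<longleftrightarrow>
     (\<forall>g\<in>carrier G. \<rho> g \<in> carrier_mat n n) \<and>
     \<rho> \<one>\<^bsub>G\<^esub> = 1\<^sub>m n \<and>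
     (\<forall>g\<in>carrier G. \<forall>h\<in>carrier G. \<rho> (g \<otimes>\<^bsub>G\<^esub> h) = \<rho> g * \<rho> h)"

text \<open>The submodule \<open>\<complex>G m\<close>: an element of \<open>\<complex>G\<close> is a coefficient function \<open>c\<close>.\<close>

definition cyclic_submodule ::
  "('a, 'b) monoid_scheme \<Rightarrow> nat \<Rightarrow> ('a \<Rightarrow> complex mat) \<Rightarrow> complex vec \<Rightarrow> complex vec set" where
  "cyclic_submodule G n \<rho> m =
     {finsum_vec TYPE(complex) n (\<lambda>g. c g \<cdot>\<^sub>v (\<rho> g *\<^sub>v m)) (carrier G) | c :: 'a \<Rightarrow> complex. True}"

definition line :: "complex vec \<Rightarrow> complex vec set" where
  "line m = {c \<cdot>\<^sub>v m | c. True}"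

text \<open>
  \<open>Length0\<close> is the chain \<open>\<complex> \<supset> 0 \<supset> \<cdots>\<close>, and \<open>Length1 n \<rho> M\<^sub>1\<close> is the chain
  \<open>\<complex>\<^sup>n \<supset> M\<^sub>1 \<supset> 0 \<supset> \<cdots>\<close> with \<open>G\<close> acting on \<open>\<complex>\<^sup>n\<close> through \<open>\<rho>\<close>.
\<close>

datatype 'a glider = Length0 | Length1 nat "'a \<Rightarrow> complex mat" "complex vec set"

fun irreducible_glider :: "('a, 'b) monoid_scheme \<Rightarrow> 'a glider \<Rightarrow> bool" where
  "irreducible_glider G Length0 \<longleftrightarrow> True"
| "irreducible_glider G (Length1 n \<rho> M1) \<longleftrightarrow>
     matrix_rep G n \<rho> \<and>
     (\<exists>m\<in>carrier_vec n. m \<noteq> 0\<^sub>v n \<and> M1 = line m \<and> carrier_vec n = cyclic_submodule G n \<rho> m)"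

fun glider_iso :: "('a, 'b) monoid_scheme \<Rightarrow> 'a glider \<Rightarrow> 'a glider \<Rightarrow> bool" where
  "glider_iso G Length0 Length0 \<longleftrightarrow> True"
| "glider_iso G (Length1 n \<rho> M1) (Length1 n' \<rho>' N1) \<longleftrightarrow>
     (\<exists>f. bij_betw f (carrier_vec n) (carrier_vec n') \<and>
        (\<forall>v\<in>carrier_vec n. \<forall>w\<in>carrier_vec n. f (v + w) = f v + f w) \<and>
        (\<forall>c. \<forall>v\<in>carrier_vec n. f (c \<cdot>\<^sub>v v) = c \<cdot>\<^sub>v f v) \<and>
        (\<forall>g\<in>carrier G. \<forall>v\<in>carrier_vec n. f (\<rho> g *\<^sub>v v) = \<rho>' g *\<^sub>v f v) \<and>
        f ` M1 = N1)"
| "glider_iso G _ _ \<longleftrightarrow> False"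


section \<open>Generalized characters\<close>

text \<open>
  For the chain \<open>G\<^sub>0 = 1 \<subset> G\<^sub>1 = G\<close> and a glider \<open>M \<supset> M\<^sub>1 \<supset> \<cdots> \<supset> M\<^sub>d \<supset> 0\<close> of essential
  length \<open>d\<close>, the subspace \<open>M\<^sub>d\<^sub>-\<^sub>i\<close> is stable under \<open>G\<^sub>i\<close> for \<open>i \<le> d\<close>; the generalized trace
  map records, at \<open>(i, g)\<close> with \<open>g \<in> G\<^sub>i\<close>, the trace of \<open>g\<close> on \<open>M\<^sub>d\<^sub>-\<^sub>i\<close>. For \<open>i = 0\<close> this is the
  trace of the identity on a line.
\<close>

fun generalized_trace :: "('a, 'b) monoid_scheme \<Rightarrow> 'a glider \<Rightarrow> nat \<times> 'a \<Rightarrow> complex option" where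
  "generalized_trace G Length0 =
     (\<lambda>(i, g). if i = 0 \<and> g = \<one>\<^bsub>G\<^esub> then Some 1 else None)"
| "generalized_trace G (Length1 n \<rho> M1) =
     (\<lambda>(i, g). if i = 0 \<and> g = \<one>\<^bsub>G\<^esub> then Some 1
               else if i = 1 \<and> g \<in> carrier G then Some (\<Sum>j<n. \<rho> g $$ (j, j)) else None)"

text \<open>
  The datum of the line \<open>M\<^sub>1\<close> inside \<open>M\<close> is recorded up to isomorphism, so that isomorphic gliders
  have equal, and non-isomorphic ones different, generalized characters.
\<close>

type_synonym 'a gen_char = "(nat \<times> 'a \<Rightarrow> complex option) \<times> 'a glider set"

definition gen_char :: "('a, 'b) monoid_scheme \<Rightarrow> 'a glider \<Rightarrow> 'a gen_char" where
  "gen_char G M = (generalized_trace G M, {N. irreducible_glider G N \<and> glider_iso G M N})"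

definition glider_rep_ring :: "('a, 'b) monoid_scheme \<Rightarrow> ('a gen_char \<Rightarrow>\<^sub>0 int) monoid" where
  "glider_rep_ring G = free_Abelian_group (gen_char G ` {M. irreducible_glider G M})"

text \<open>
  Here \<open>\<phi> : G \<rightarrow> character_group G\<close> is the fixed identification, \<open>T\<^sub>g\<close> is \<open>\<complex>\<close> with \<open>G\<close> acting through
  the character \<open>\<phi> g\<close>, and a subset \<open>A\<close> of \<open>G\<close> is given by a repetition-free list \<open>xs\<close> of its
  elements. The module is the direct sum of the \<open>T\<^sub>g\<close> in the order of \<open>xs\<close>, and the vector has the
  coordinate \<open>t g\<close> in the summand \<open>T\<^sub>g\<close>.
\<close>

definition one_dim_rep :: "('a \<Rightarrow> 'a \<Rightarrow> complex) \<Rightarrow> 'a \<Rightarrow> 'a \<Rightarrow> complex mat" where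
  "one_dim_rep \<phi> g h = mat 1 1 (\<lambda>_. \<phi> g h)"

definition subset_glider ::
  "('a \<Rightarrow> 'a \<Rightarrow> complex) \<Rightarrow> 'a list \<Rightarrow> ('a \<Rightarrow> complex) \<Rightarrow> 'a glider" where
  "subset_glider \<phi> xs t =
     (if xs = [] then Length0
      else Length1 (length xs)
             (\<lambda>h. diag_block_mat (map (\<lambda>g. one_dim_rep \<phi> g h) xs))
             (line (vec_of_list (map t xs))))"


section \<open>Extension of scalars \<open>\<complex> \<otimes> A\<close> over the integers\<close>

text \<open>
  The tensor product is the quotient of the free abelian group on \<open>\<complex> \<times> A\<close> by the biadditivity
  relations. The abelian group \<open>A\<close> is written multiplicatively, as usual for
  \<^typ>\<open>'a monoid\<close>.
\<close>

definition tensor_relations :: "('b, 'c) monoid_scheme \<Rightarrow> (complex \<times> 'b \<Rightarrow>\<^sub>0 int) set" where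
  "tensor_relations A =
     {frag_of (c + d, x) - frag_of (c, x) - frag_of (d, x) | c d x. x \<in> carrier A} \<union>
     {frag_of (c, x \<otimes>\<^bsub>A\<^esub> y) - frag_of (c, x) - frag_of (c, y) | c x y.
        x \<in> carrier A \<and> y \<in> carrier A}"

definition pre_tensor :: "('b, 'c) monoid_scheme \<Rightarrow> (complex \<times> 'b \<Rightarrow>\<^sub>0 int) monoid" where
  "pre_tensor A = free_Abelian_group (UNIV \<times> carrier A)"

definition tensor_kernel :: "('b, 'c) monoid_scheme \<Rightarrow> (complex \<times> 'b \<Rightarrow>\<^sub>0 int) set" where
  "tensor_kernel A = generate (pre_tensor A) (tensor_relations A)"

text \<open>
  The scalar action is induced by \<open>z \<cdot> (c, x) = (z c, x)\<close>; adding the kernel to the image of a coset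
  makes this correct for \<open>z = 0\<close> too. The ring multiplication of the record is irrelevant.
\<close>

definition complex_tensor ::
  "('b, 'c) monoid_scheme \<Rightarrow> (complex, (complex \<times> 'b \<Rightarrow>\<^sub>0 int) set) module" where
  "complex_tensor A =
     \<lparr>carrier = carrier (pre_tensor A Mod tensor_kernel A),
      monoid.mult = undefined,
      one = undefined,
      ring.zero = \<one>\<^bsub>pre_tensor A Mod tensor_kernel A\<^esub>,
      ring.add = monoid.mult (pre_tensor A Mod tensor_kernel A),
      smult = (\<lambda>z X. tensor_kernel A <#>\<^bsub>pre_tensor A\<^esub>
                 frag_extend (\<lambda>(c, x). frag_of (z * c, x)) ` X)\<rparr>"

definition pure_tensor :: "('b, 'c) monoid_scheme \<Rightarrow> complex \<Rightarrow> 'b \<Rightarrow> (complex \<times> 'b \<Rightarrow>\<^sub>0 int) set" where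
  "pure_tensor A c x = tensor_kernel A #>\<^bsub>pre_tensor A\<^esub> frag_of (c, x)"

text \<open>Independence of a family, as opposed to its range: repetitions are not allowed.\<close>

definition lin_indpt_family ::
  "('k, 'r) ring_scheme \<Rightarrow> ('k, 'v, 's) module_scheme \<Rightarrow> ('i \<Rightarrow> 'v) \<Rightarrow> 'i set \<Rightarrow> bool" where
  "lin_indpt_family K V v I \<longleftrightarrow>
     inj_on v I \<and> LinearCombinations.module.lin_indpt K V (v ` I)"

end

theory Submission
  imports Defs
begin

text \<open>
  Orthogonality of characters makes \<open>\<Sum>g\<in>A. t\<^sub>g\<close> a cyclic vector of \<open>\<Oplus>g\<in>A. T\<^sub>g\<close>, and lets the
  trace of this module determine \<open>A\<close>. So the \<open>\<chi>\<^sub>A\<close> are pairwise distinct members of the basis of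
  \<open>R(G)\<close>, and their independence after extension of scalars is witnessed by the
  coordinate functionals, extended to \<open>\<complex> \<otimes> R(G)\<close> by the universal property of the tensor product.
\<close>

section \<open>Extension of scalars\<close>

text \<open>Scaling before passing to the quotient: strictly additive in the element, but additive
  in \<open>z\<close> only modulo \<open>tensor_kernel\<close>.\<close>

abbreviation tensor_scale :: "complex \<Rightarrow> (complex \<times> 'b \<Rightarrow>\<^sub>0 int) \<Rightarrow> (complex \<times> 'b \<Rightarrow>\<^sub>0 int)" where
  "tensor_scale z \<equiv> frag_extend (\<lambda>(c, x). frag_of (z * c, x))"

section \<open>The free abelian group on pairs of a scalar and a group element\<close>

lemma comm_group_pre_tensor: "comm_group (pre_tensor A)"
  by (simp add: pre_tensor_def abelian_free_Abelian_group)

lemma mult_pre_tensor [simp]: "p \<otimes>\<^bsub>pre_tensor A\<^esub> q = p + q"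
  by (simp add: pre_tensor_def)

lemma one_pre_tensor [simp]: "\<one>\<^bsub>pre_tensor A\<^esub> = 0"
  by (simp add: pre_tensor_def)

lemma inv_pre_tensor [simp]: "p \<in> carrier (pre_tensor A) \<Longrightarrow> inv\<^bsub>pre_tensor A\<^esub> p = - p"
  by (simp add: pre_tensor_def)

lemma add_pre_tensor_closed:
  "\<lbrakk>p \<in> carrier (pre_tensor A); q \<in> carrier (pre_tensor A)\<rbrakk> \<Longrightarrow> p + q \<in> carrier (pre_tensor A)"
  using monoid.m_closed[OF group.is_monoid[OF comm_group.axioms(2)[OF comm_group_pre_tensor]]]
  by fastforce

lemma diff_pre_tensor_closed:
  "\<lbrakk>p \<in> carrier (pre_tensor A); q \<in> carrier (pre_tensor A)\<rbrakk> \<Longrightarrow> p - q \<in> carrier (pre_tensor A)"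
  unfolding pre_tensor_def carrier_free_Abelian_group_iff using keys_diff[of p q] by blast

lemma frag_of_pre_tensor [simp]:
  "frag_of (c, x) \<in> carrier (pre_tensor A) \<longleftrightarrow> x \<in> carrier A"
  by (simp add: pre_tensor_def)

text \<open>Closure under differences yields negatives and sums as well, so additive statements
  reduce to generators.\<close>

lemma pre_tensor_induct [consumes 1, case_names zero diff frag]:
  assumes "p \<in> carrier (pre_tensor A)" "P 0"
    and "\<And>p q. \<lbrakk>p \<in> carrier (pre_tensor A); q \<in> carrier (pre_tensor A); P p; P q\<rbrakk> \<Longrightarrow> P (p - q)"
    and "\<And>c x. x \<in> carrier A \<Longrightarrow> P (frag_of (c, x))"
  shows "P p"
  by (rule free_Abelian_group_induct[of p "UNIV \<times> carrier A"])
     (use assms in \<open>auto simp: pre_tensor_def\<close>)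

section \<open>Biadditivity relations, the subgroup they generate, and scaling\<close>

context comm_group
begin

lemma tensor_relations_closed: "tensor_relations G \<subseteq> carrier (pre_tensor G)"
  unfolding tensor_relations_def by (auto intro!: diff_pre_tensor_closed)

lemma subgroup_tensor_kernel: "subgroup (tensor_kernel G) (pre_tensor G)"
  unfolding tensor_kernel_def
  using group.generate_is_subgroup comm_group.axioms(2)[OF comm_group_pre_tensor]
    tensor_relations_closed by blast

lemma normal_tensor_kernel: "tensor_kernel G \<lhd> pre_tensor G"
  by (rule comm_group.subgroup_imp_normal[OF comm_group_pre_tensor subgroup_tensor_kernel])

lemma add_tensor_kernel_closed:
  "\<lbrakk>p \<in> tensor_kernel G; q \<in> tensor_kernel G\<rbrakk> \<Longrightarrow> p + q \<in> tensor_kernel G"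
  using subgroup.m_closed[OF subgroup_tensor_kernel] by simp

lemma tensor_kernel_carrier: "p \<in> tensor_kernel G \<Longrightarrow> p \<in> carrier (pre_tensor G)"
  by (rule subgroup.mem_carrier[OF subgroup_tensor_kernel])

lemma zero_tensor_kernel: "0 \<in> tensor_kernel G"
  using subgroup.one_closed[OF subgroup_tensor_kernel] by simp

lemma diff_tensor_kernel_closed:
  assumes "p \<in> tensor_kernel G" "q \<in> tensor_kernel G"
  shows "p - q \<in> tensor_kernel G"
  using subgroup.m_closed[OF subgroup_tensor_kernel assms(1)
      subgroup.m_inv_closed[OF subgroup_tensor_kernel assms(2)]] tensor_kernel_carrier[OF assms(2)]
  by simp

lemma tensor_relations_kernel: "p \<in> tensor_relations G \<Longrightarrow> p \<in> tensor_kernel G"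
  unfolding tensor_kernel_def by (rule generate.incl)

lemma tensor_scale_closed:
  "p \<in> carrier (pre_tensor G) \<Longrightarrow> tensor_scale z p \<in> carrier (pre_tensor G)"
proof (induction p rule: pre_tensor_induct)
  case zero
  show ?case using zero_tensor_kernel tensor_kernel_carrier by simp
qed (auto simp: frag_extend_diff diff_pre_tensor_closed)

lemma tensor_scale_hom: "group_hom (pre_tensor G) (pre_tensor G) (tensor_scale z)"
  by (intro group_hom.intro group_hom_axioms.intro homI comm_group.axioms(2)[OF comm_group_pre_tensor])
     (auto simp: tensor_scale_closed frag_extend_add)

text \<open>Since \<open>z * (c + d) = z * c + z * d\<close>, scaling sends either kind of relation
  to one of the same kind; this lets it descend to the quotient.\<close>

lemma tensor_scale_relations:
  "p \<in> tensor_relations G \<Longrightarrow> tensor_scale z p \<in> tensor_relations G"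
  unfolding tensor_relations_def
  by (auto simp: frag_extend_diff ring_distribs)

text \<open>A homomorphism carries the subgroup generated by the relations to the one generated by
  their images, and these images are again relations.\<close>

lemma tensor_scale_kernel:
  assumes "p \<in> tensor_kernel G"
  shows "tensor_scale z p \<in> tensor_kernel G"
proof -
  have "tensor_scale z ` tensor_kernel G
      = generate (pre_tensor G) (tensor_scale z ` tensor_relations G)"
    unfolding tensor_kernel_def
    using group_hom.generate_img[OF tensor_scale_hom tensor_relations_closed] by blast
  also have "\<dots> \<subseteq> tensor_kernel G"
    unfolding tensor_kernel_def
    by (rule group.mono_generate[OF comm_group.axioms(2)[OF comm_group_pre_tensor]])
       (auto intro: tensor_scale_relations)
  finally show ?thesis using assms by blast
qed

section \<open>Cosets of the kernel as a complex vector space\<close>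

definition tensor_class :: "(complex \<times> 'a \<Rightarrow>\<^sub>0 int) \<Rightarrow> (complex \<times> 'a \<Rightarrow>\<^sub>0 int) set" where
  "tensor_class p = tensor_kernel G #>\<^bsub>pre_tensor G\<^esub> p"

lemma tensor_class_altdef: "tensor_class p = {k + p | k. k \<in> tensor_kernel G}"
  by (auto simp: tensor_class_def r_coset_def)

lemma tensor_class_eqI:
  assumes "p - q \<in> tensor_kernel G"
  shows "tensor_class p = tensor_class q"
proof -
  have "\<exists>k'. k + p = k' + q \<and> k' \<in> tensor_kernel G" if "k \<in> tensor_kernel G" for k
    by (rule exI[of _ "k + (p - q)"]) (use assms that add_tensor_kernel_closed in auto)
  moreover have "\<exists>k'. k + q = k' + p \<and> k' \<in> tensor_kernel G" if "k \<in> tensor_kernel G" for k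
    by (rule exI[of _ "k - (p - q)"]) (use assms that diff_tensor_kernel_closed in auto)
  ultimately show ?thesis unfolding tensor_class_altdef by blast
qed

lemma abelian_group_complex_tensor: "abelian_group (complex_tensor G)"
proof -
  interpret Q: comm_group "pre_tensor G Mod tensor_kernel G"
    by (rule comm_group.abelian_FactGroup[OF comm_group_pre_tensor subgroup_tensor_kernel])
  have [simp]: "carrier (complex_tensor G) = carrier (pre_tensor G Mod tensor_kernel G)"
    "x \<oplus>\<^bsub>complex_tensor G\<^esub> y = x \<otimes>\<^bsub>pre_tensor G Mod tensor_kernel G\<^esub> y"
    "\<zero>\<^bsub>complex_tensor G\<^esub> = \<one>\<^bsub>pre_tensor G Mod tensor_kernel G\<^esub>" for x y
    by (simp_all add: complex_tensor_def)
  show ?thesis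
    \<comment> \<open>With the quotient operations kept folded, the goals follow from the laws of
      the commutative group \<open>Q\<close>, without coset arithmetic.\<close>
    by (rule abelian_groupI; simp del: mult_FactGroup one_FactGroup)
       (simp_all add: Q.m_ac Q.l_inv_ex del: mult_FactGroup one_FactGroup)
qed

lemma carrier_complex_tensor: "carrier (complex_tensor G) = tensor_class ` carrier (pre_tensor G)"
  by (simp add: complex_tensor_def carrier_FactGroup tensor_class_def image_def)

lemma add_tensor_class:
  "\<lbrakk>p \<in> carrier (pre_tensor G); q \<in> carrier (pre_tensor G)\<rbrakk> \<Longrightarrow>
    tensor_class p \<oplus>\<^bsub>complex_tensor G\<^esub> tensor_class q = tensor_class (p + q)"
  using normal.rcos_sum[OF normal_tensor_kernel]
  by (simp add: complex_tensor_def tensor_class_def)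

text \<open>Writing \<open>K\<close> for the kernel, the action sends the coset \<open>K + p\<close>
  to \<open>K + zK + zp\<close>, and \<open>K + zK = K\<close>.\<close>

lemma smult_tensor_class:
  assumes "p \<in> carrier (pre_tensor G)"
  shows "z \<odot>\<^bsub>complex_tensor G\<^esub> tensor_class p = tensor_class (tensor_scale z p)"
proof -
  have "z \<odot>\<^bsub>complex_tensor G\<^esub> tensor_class p
      = {k + tensor_scale z (k' + p) | k k'. k \<in> tensor_kernel G \<and> k' \<in> tensor_kernel G}"
    by (auto simp: complex_tensor_def tensor_class_altdef set_mult_def)
  also have "\<dots> = {k + tensor_scale z k' + tensor_scale z p | k k'.
      k \<in> tensor_kernel G \<and> k' \<in> tensor_kernel G}"
    by (simp add: frag_extend_add add.assoc)
  \<comment> \<open>One inclusion holds because scaling preserves the kernel; the other takes 0 as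
    the scaled kernel element.\<close>
  also have "\<dots> = {k + tensor_scale z p | k. k \<in> tensor_kernel G}"
  proof safe
    fix k k' assume "k \<in> tensor_kernel G" "k' \<in> tensor_kernel G"
    then show "\<exists>l. k + tensor_scale z k' + tensor_scale z p = l + tensor_scale z p
        \<and> l \<in> tensor_kernel G"
      using tensor_scale_kernel add_tensor_kernel_closed by blast
  next
    fix k assume "k \<in> tensor_kernel G"
    then show "\<exists>l k'. k + tensor_scale z p = l + tensor_scale z k' + tensor_scale z p
        \<and> l \<in> tensor_kernel G \<and> k' \<in> tensor_kernel G"
      using zero_tensor_kernel by (intro exI[of _ k] exI[of _ 0]) auto
  qed
  finally show ?thesis unfolding tensor_class_altdef .
qed

text \<open>This is the linearity law that fails in the free group itself. On a generator the defect
  is exactly a relation of additivity in the scalar.\<close>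

lemma tensor_scale_add_kernel:
  assumes "p \<in> carrier (pre_tensor G)"
  shows "tensor_scale (a + b) p - (tensor_scale a p + tensor_scale b p) \<in> tensor_kernel G"
  using assms
proof (induction p rule: pre_tensor_induct)
  case zero
  show ?case using zero_tensor_kernel by simp
next
  case (diff p q)
  from diff_tensor_kernel_closed[OF diff.IH] show ?case
    by (simp add: frag_extend_diff algebra_simps)
next
  case (frag c x)
  then have "frag_of (a * c + b * c, x) - frag_of (a * c, x) - frag_of (b * c, x) \<in> tensor_relations G"
    unfolding tensor_relations_def by blast
  then show ?case
    using tensor_relations_kernel by (simp add: algebra_simps)
qed

lemma tensor_scale_tensor_scale: "tensor_scale a (tensor_scale b p) = tensor_scale (a * b) p"
  using subset_UNIV[of "Poly_Mapping.keys p"]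
  by (induction p rule: frag_induction) (auto simp: frag_extend_diff mult.assoc)

lemma tensor_scale_one: "tensor_scale 1 p = p"
  using subset_UNIV[of "Poly_Mapping.keys p"]
  by (induction p rule: frag_induction) (auto simp: frag_extend_diff)

lemma module_complex_tensor: "module (class_ring :: complex ring) (complex_tensor G)"
proof -
  have cring: "cring (class_ring :: complex ring)"
    by (rule fieldE(1)[OF class_field])
  show ?thesis
  proof (rule Module.module.intro[OF cring abelian_group_complex_tensor Module.module_axioms.intro],
      goal_cases)
    \<comment> \<open>The cases are closure, distributivity over scalars, distributivity over
      vectors, associativity and the unit law. Only the second changes the representative of a
      coset.\<close>
    case (1 a X)
    then show ?case by (auto simp: class_ring_simps carrier_complex_tensor smult_tensor_class tensor_scale_closed)
  next
    case (2 a b X)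
    then show ?case
      by (auto simp: class_ring_simps carrier_complex_tensor smult_tensor_class tensor_scale_closed
          add_tensor_class
          tensor_class_eqI[OF tensor_scale_add_kernel])
  next
    case (3 a X Y)
    then show ?case
      by (auto simp: class_ring_simps carrier_complex_tensor smult_tensor_class tensor_scale_closed
          add_tensor_class
          add_pre_tensor_closed frag_extend_add)
  next
    case (4 a b X)
    then show ?case
      by (auto simp: class_ring_simps carrier_complex_tensor smult_tensor_class tensor_scale_closed
          tensor_scale_tensor_scale)
  next
    case (5 X)
    then obtain p where "p \<in> carrier (pre_tensor G)" "X = tensor_class p"
      by (auto simp: carrier_complex_tensor)
    then show ?case
      unfolding class_ring_simps by (simp only: monoid.simps smult_tensor_class tensor_scale_one)
  qed
qed

lemma pure_tensor_eq_tensor_class: "pure_tensor G c x = tensor_class (frag_of (c, x))"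
  by (simp add: pure_tensor_def tensor_class_def)

lemma pure_tensor_closed: "x \<in> carrier G \<Longrightarrow> pure_tensor G c x \<in> carrier (complex_tensor G)"
  by (simp add: pure_tensor_eq_tensor_class carrier_complex_tensor)

text \<open>The map sending \<open>(c, x)\<close> to \<open>c * \<epsilon> x\<close> extends to the
  free group and kills the relations, so it factors through the quotient. With a coordinate as
  \<open>\<epsilon>\<close>, this supplies the functionals of the final argument.\<close>

lemma complex_tensor_functional:
  fixes \<epsilon> :: "'a \<Rightarrow> complex"
  assumes \<epsilon>: "\<And>x y. \<lbrakk>x \<in> carrier G; y \<in> carrier G\<rbrakk> \<Longrightarrow> \<epsilon> (x \<otimes> y) = \<epsilon> x + \<epsilon> y"
  obtains L :: "(complex \<times> 'a \<Rightarrow>\<^sub>0 int) set \<Rightarrow> complex"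
  where "\<And>X Y. \<lbrakk>X \<in> carrier (complex_tensor G); Y \<in> carrier (complex_tensor G)\<rbrakk> \<Longrightarrow>
           L (X \<oplus>\<^bsub>complex_tensor G\<^esub> Y) = L X + L Y"
    and "\<And>z X. X \<in> carrier (complex_tensor G) \<Longrightarrow> L (z \<odot>\<^bsub>complex_tensor G\<^esub> X) = z * L X"
    and "\<And>c x. x \<in> carrier G \<Longrightarrow> L (pure_tensor G c x) = c * \<epsilon> x"
proof -
  \<comment> \<open>The additive group of the complex numbers, as target for the universal property
    of the free abelian group.\<close>
  define C where "C = add_monoid (class_ring :: complex ring)"
  have "ring (class_ring :: complex ring)"
    by (rule cring.axioms(1)[OF fieldE(1)[OF class_field]])
  then interpret C: comm_group C
    unfolding C_def by (rule abelian_group.a_comm_group[OF ring.is_abelian_group])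
  have [simp]: "carrier C = UNIV" "u \<otimes>\<^bsub>C\<^esub> v = u + v" "\<one>\<^bsub>C\<^esub> = 0" for u v
    by (simp_all add: C_def class_ring_simps)
  obtain h where h: "h \<in> hom (pre_tensor G) C"
    and h_frag': "\<And>p. p \<in> UNIV \<times> carrier G \<Longrightarrow> h (frag_of p) = (case p of (c, x) \<Rightarrow> c * \<epsilon> x)"
    using C.free_Abelian_group_universal
      [of "\<lambda>(c, x). c * \<epsilon> x" "UNIV \<times> carrier G"] unfolding pre_tensor_def by auto
  have h_frag: "h (frag_of (c, x)) = c * \<epsilon> x" if "x \<in> carrier G" for c x
    using h_frag'[of "(c, x)"] that by simp
  interpret h: group_hom "pre_tensor G" C h
    using h comm_group.axioms(2)[OF comm_group_pre_tensor]
    by (intro group_hom.intro group_hom_axioms.intro) auto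
  have h_add: "h (p + q) = h p + h q"
    if "p \<in> carrier (pre_tensor G)" "q \<in> carrier (pre_tensor G)" for p q
    using h.hom_mult[OF that] by simp
  have h_diff: "h (p - q) = h p - h q"
    if "p \<in> carrier (pre_tensor G)" "q \<in> carrier (pre_tensor G)" for p q
    using h_add[OF diff_pre_tensor_closed[OF that] that(2)] by simp
  have h_kernel: "h p = 0" if "p \<in> tensor_kernel G" for p
  proof -
    \<comment> \<open>The kernel of \<open>h\<close> is a subgroup, so checking the relations
      suffices: they vanish by distributivity and by additivity of
      \<open>\<epsilon>\<close>.\<close>
    have "tensor_relations G \<subseteq> kernel (pre_tensor G) C h"
    proof
      fix r assume r: "r \<in> tensor_relations G"
      then have "h r = 0"
        unfolding tensor_relations_def
        by (auto simp: h_diff h_frag diff_pre_tensor_closed \<epsilon> ring_distribs)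
      with r tensor_relations_closed show "r \<in> kernel (pre_tensor G) C h"
        by (auto simp: kernel_def)
    qed
    then have "tensor_kernel G \<subseteq> kernel (pre_tensor G) C h"
      unfolding tensor_kernel_def
      using h.subgroup_kernel by (intro group.generate_subgroup_incl[OF h.is_group]) auto
    with that show ?thesis by (auto simp: kernel_def)
  qed
  have h_scale: "h (tensor_scale z p) = z * h p" if "p \<in> carrier (pre_tensor G)" for z p
    using that
  proof (induction p rule: pre_tensor_induct)
    case zero
    show ?case using h.hom_one by simp
  qed (auto simp: frag_extend_diff h_diff h_frag tensor_scale_closed ring_distribs)
  obtain L where L: "\<And>p. p \<in> carrier (pre_tensor G) \<Longrightarrow> L (tensor_class p) = h p"
  proof -
    assume *: "\<And>L. (\<And>p. p \<in> carrier (pre_tensor G) \<Longrightarrow> L (tensor_class p) = h p) \<Longrightarrow> thesis"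
    show ?thesis
    proof (rule FactGroup_universal[OF h normal_tensor_kernel])
      fix p q
      assume pq: "p \<in> carrier (pre_tensor G)" "q \<in> carrier (pre_tensor G)"
        "tensor_kernel G #>\<^bsub>pre_tensor G\<^esub> p = tensor_kernel G #>\<^bsub>pre_tensor G\<^esub> q"
      \<comment> \<open>Since 0 is in the kernel, \<open>p\<close> lies in its own coset, hence in
        that of \<open>q\<close>; so \<open>p\<close> is \<open>q\<close> plus a kernel element,
        which \<open>h\<close> kills.\<close>
      then have "p \<in> tensor_class q"
        using zero_tensor_kernel by (force simp: tensor_class_altdef simp flip: tensor_class_def)
      with pq h_kernel tensor_kernel_carrier show "h p = h q"
        by (auto simp: tensor_class_altdef h_add)
    qed (use * in \<open>auto simp: tensor_class_def\<close>)
  qed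
  show thesis
  proof (rule that[of L])
    show "L (pure_tensor G c x) = c * \<epsilon> x" if "x \<in> carrier G" for c x
      using that by (simp add: pure_tensor_eq_tensor_class L h_frag)
  qed (auto simp: carrier_complex_tensor add_tensor_class smult_tensor_class L h_add h_scale
      add_pre_tensor_closed tensor_scale_closed)
qed

end

text \<open>Applying \<open>L i\<close> to a vanishing combination isolates the coefficient of
  \<open>v i\<close>, which must therefore be zero.\<close>

lemma lin_indpt_familyI_dual:
  fixes V :: "(complex, 'v) module"
  assumes "module (class_ring :: complex ring) V"
    and v: "\<And>i. i \<in> I \<Longrightarrow> v i \<in> carrier V"
    and add: "\<And>i x y. \<lbrakk>i \<in> I; x \<in> carrier V; y \<in> carrier V\<rbrakk> \<Longrightarrow> L i (x \<oplus>\<^bsub>V\<^esub> y) = L i x + L i y"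
    and smult: "\<And>i c x. \<lbrakk>i \<in> I; x \<in> carrier V\<rbrakk> \<Longrightarrow> L i (c \<odot>\<^bsub>V\<^esub> x) = c * L i x"
    and dual: "\<And>i j. \<lbrakk>i \<in> I; j \<in> I\<rbrakk> \<Longrightarrow> L i (v j) = (if i = j then 1 else (0 :: complex))"
  shows "lin_indpt_family (class_ring :: complex ring) V v I"
  unfolding lin_indpt_family_def
proof
  interpret V: Module.module "class_ring :: complex ring" V by fact
  show inj: "inj_on v I"
    \<comment> \<open>A repetition \<open>v i = v j\<close> with distinct indices would make
      \<open>L i\<close> take both values 1 and 0 there.\<close>
    by (rule inj_onI) (metis dual zero_neq_one)
  have zero: "L i \<zero>\<^bsub>V\<^esub> = 0" if "i \<in> I" for i
    using add[OF that V.zero_closed V.zero_closed] by simp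
  have L_lincomb: "L i (V.lincomb a S) = (\<Sum>x\<in>S. a x * L i x)"
    if "i \<in> I" "finite S" "S \<subseteq> carrier V" for i a S
    using that(2,3)
  proof (induction S rule: finite_induct)
    case empty
    show ?case by (simp add: V.lincomb_def zero that)
  next
    case (insert x S)
    have "V.lincomb a (insert x S) = a x \<odot>\<^bsub>V\<^esub> x \<oplus>\<^bsub>V\<^esub> V.lincomb a S"
      unfolding V.lincomb_def using insert
      by (intro V.finsum_insert) (auto simp: class_ring_simps)
    moreover have "V.lincomb a S \<in> carrier V"
      using insert by (intro V.lincomb_closed) (auto simp: class_ring_simps)
    moreover have "a x \<odot>\<^bsub>V\<^esub> x \<in> carrier V"
      using insert by (intro V.smult_closed) (auto simp: class_ring_simps)
    ultimately show ?case
      using insert that(1) by (simp add: add smult)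
  qed
  show "V.lin_indpt (v ` I)"
  proof
    assume "V.lin_dep (v ` I)"
    then obtain S a x where S: "finite S" "S \<subseteq> v ` I" "V.lincomb a S = \<zero>\<^bsub>V\<^esub>" "x \<in> S"
      and "a x \<noteq> \<zero>\<^bsub>class_ring :: complex ring\<^esub>"
      unfolding V.lin_dep_def by blast
    then have ax: "a x \<noteq> 0" by (simp add: class_ring_simps)
    from S obtain i where i: "i \<in> I" "x = v i" by blast
    have "0 = L i (V.lincomb a S)" using S zero i by simp
    also have "\<dots> = (\<Sum>y\<in>S. a y * L i y)"
      using S v i by (intro L_lincomb) auto
    \<comment> \<open>Duality kills the term of \<open>v j\<close> unless \<open>j = i\<close>, and
      injectivity of \<open>v\<close> identifies this condition with \<open>y = x\<close>.\<close>
    also have "\<dots> = (\<Sum>y\<in>S. if y = x then a x else 0)"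
    proof (rule sum.cong)
      fix y assume "y \<in> S"
      with S obtain j where "j \<in> I" "y = v j" by blast
      with i show "a y * L i y = (if y = x then a x else 0)"
        using dual[of i j] inj by (auto simp: inj_on_eq_iff)
    qed simp
    also have "\<dots> = a x" using S by simp
    finally show False using ax by simp
  qed
qed

section \<open>Orthogonality of characters\<close>

text \<open>\<open>\<phi>\<close> acts as a bimultiplicative pairing on \<open>G\<close>: on the
  right because each \<open>\<phi> g\<close> is a character, on the left because
  \<open>\<phi>\<close> is a homomorphism.\<close>

locale self_dual_group = comm_group G for G :: "('a, 'b) monoid_scheme" (structure) +
  fixes \<phi> :: "'a \<Rightarrow> 'a \<Rightarrow> complex"
  assumes fin: "finite (carrier G)"
    and iso: "\<phi> \<in> iso G (character_group G)"
begin

lemma \<phi>_character: "g \<in> carrier G \<Longrightarrow> \<phi> g \<in> hom G complex_units \<inter> extensional (carrier G)"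
  using iso by (auto simp: iso_def hom_def character_group_def)

lemma \<phi>_nonzero: "\<lbrakk>g \<in> carrier G; h \<in> carrier G\<rbrakk> \<Longrightarrow> \<phi> g h \<noteq> 0"
  using \<phi>_character[of g] by (auto simp: hom_def complex_units_def)

lemma \<phi>_mult_right:
  "\<lbrakk>g \<in> carrier G; h \<in> carrier G; k \<in> carrier G\<rbrakk> \<Longrightarrow> \<phi> g (h \<otimes> k) = \<phi> g h * \<phi> g k"
  using \<phi>_character[of g] by (auto simp: hom_def complex_units_def)

lemma \<phi>_mult_left:
  "\<lbrakk>g \<in> carrier G; h \<in> carrier G; k \<in> carrier G\<rbrakk> \<Longrightarrow> \<phi> (g \<otimes> h) k = \<phi> g k * \<phi> h k"
  using iso by (auto simp: iso_def hom_def character_group_def)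

lemma \<phi>_one_right [simp]: "g \<in> carrier G \<Longrightarrow> \<phi> g \<one> = 1"
  using \<phi>_mult_right[of g \<one> \<one>] \<phi>_nonzero[of g \<one>] by simp

lemma \<phi>_one_left [simp]: "k \<in> carrier G \<Longrightarrow> \<phi> \<one> k = 1"
  using \<phi>_mult_left[of \<one> \<one> k] \<phi>_nonzero[of \<one> k] by simp

lemma \<phi>_inv_left: "\<lbrakk>g \<in> carrier G; k \<in> carrier G\<rbrakk> \<Longrightarrow> \<phi> (inv g) k = inverse (\<phi> g k)"
  using \<phi>_mult_left[of g "inv g" k] \<phi>_nonzero[of g k] by (simp add: field_simps)

text \<open>For nontrivial \<open>g\<close>, translation by some \<open>k\<close> with
  \<open>\<phi> g k \<noteq> 1\<close> permutes the summands and also multiplies the sum by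
  \<open>\<phi> g k\<close>, so the sum is 0.\<close>

lemma \<phi>_sum:
  assumes g: "g \<in> carrier G"
  shows "(\<Sum>h\<in>carrier G. \<phi> g h) = (if g = \<one> then of_nat (card (carrier G)) else 0)"
proof (cases "g = \<one>")
  case False
  \<comment> \<open>Otherwise \<open>\<phi> g\<close> and \<open>\<phi> \<one>\<close> agree on the
    carrier and, being extensional, coincide, against injectivity of \<open>\<phi>\<close>.\<close>
  obtain k where k: "k \<in> carrier G" "\<phi> g k \<noteq> 1"
  proof (rule ccontr)
    assume "\<not> thesis"
    with that have "\<And>k. k \<in> carrier G \<Longrightarrow> \<phi> g k = \<phi> \<one> k" by auto
    then have "\<phi> g = \<phi> \<one>"
      using \<phi>_character[OF g] \<phi>_character[OF one_closed] by (intro extensionalityI) auto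
    then show False
      using False iso g by (auto simp: iso_def bij_betw_def inj_on_def)
  qed
  have "bij_betw (\<lambda>h. k \<otimes> h) (carrier G) (carrier G)"
    unfolding bij_betw_def using k inj_on_cmult surj_const_mult by auto
  then have "(\<Sum>h\<in>carrier G. \<phi> g h) = (\<Sum>h\<in>carrier G. \<phi> g (k \<otimes> h))"
    by (rule sum.reindex_bij_betw[symmetric])
  also have "\<dots> = \<phi> g k * (\<Sum>h\<in>carrier G. \<phi> g h)"
    unfolding sum_distrib_left using k g by (intro sum.cong) (auto simp: \<phi>_mult_right)
  finally show ?thesis using k False by auto
qed auto

text \<open>Bimultiplicativity merges the two factors into the single character
  \<open>\<phi> (a \<otimes> inv g)\<close>, to which \<open>\<phi>_sum\<close> applies.\<close>

lemma \<phi>_orthogonal: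
  assumes "a \<in> carrier G" "g \<in> carrier G"
  shows "(\<Sum>h\<in>carrier G. \<phi> a h * inverse (\<phi> g h)) = (if a = g then of_nat (card (carrier G)) else 0)"
proof -
  have "(\<Sum>h\<in>carrier G. \<phi> a h * inverse (\<phi> g h)) = (\<Sum>h\<in>carrier G. \<phi> (a \<otimes> inv g) h)"
    using assms by (intro sum.cong) (auto simp: \<phi>_mult_left \<phi>_inv_left)
  also have "\<dots> = (if a \<otimes> inv g = \<one> then of_nat (card (carrier G)) else 0)"
    using assms by (simp add: \<phi>_sum)
  also have "a \<otimes> inv g = \<one> \<longleftrightarrow> a = g"
    using assms by (metis inv_closed inv_equality inv_inv r_inv)
  finally show ?thesis .
qed

lemma card_carrier_nonzero: "of_nat (card (carrier G)) \<noteq> (0 :: complex)"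
  using fin one_closed by auto

text \<open>Fourier inversion: pairing the sum over \<open>S\<close> with the inverse of
  \<open>\<phi> g\<close> gives the order of \<open>G\<close> if \<open>g \<in> S\<close> and 0
  otherwise, so the sum recovers \<open>S\<close>.\<close>

lemma sum_\<phi>_inject:
  assumes AB: "A \<subseteq> carrier G" "B \<subseteq> carrier G"
    and eq: "\<And>h. h \<in> carrier G \<Longrightarrow> (\<Sum>g\<in>A. \<phi> g h) = (\<Sum>g\<in>B. \<phi> g h)"
  shows "A = B"
proof -
  have mem: "g \<in> S \<longleftrightarrow> (\<Sum>h\<in>carrier G. (\<Sum>a\<in>S. \<phi> a h) * inverse (\<phi> g h)) \<noteq> 0"
    if g: "g \<in> carrier G" and S: "S \<subseteq> carrier G" for g S
  proof -
    have "(\<Sum>h\<in>carrier G. (\<Sum>a\<in>S. \<phi> a h) * inverse (\<phi> g h))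
        = (\<Sum>a\<in>S. \<Sum>h\<in>carrier G. \<phi> a h * inverse (\<phi> g h))"
      unfolding sum_distrib_right by (rule sum.swap)
    also have "\<dots> = (\<Sum>a\<in>S. if a = g then of_nat (card (carrier G)) else 0)"
      using g S by (intro sum.cong) (auto simp: \<phi>_orthogonal)
    also have "\<dots> = (if g \<in> S then of_nat (card (carrier G)) else 0)"
      using finite_subset[OF S fin] by simp
    finally show ?thesis using card_carrier_nonzero by auto
  qed
  have "g \<in> A \<longleftrightarrow> g \<in> B" if "g \<in> carrier G" for g
    unfolding mem[OF that AB(1)] mem[OF that AB(2)] using eq by simp
  with AB show ?thesis by blast
qed

end

section \<open>The gliders of subsets\<close>

text \<open>Makes the direct sum of one-dimensional representations an explicit diagonal matrix, so
  that products and actions are computed entrywise.\<close>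

lemma diag_block_mat_one_dim:
  "diag_block_mat (map (\<lambda>x. mat 1 1 (\<lambda>_. f x)) xs)
    = mat (length xs) (length xs) (\<lambda>(i, j). if i = j then f (xs ! i) else 0)"
proof (induction xs)
  case (Cons x xs)
  show ?case
    by (rule eq_matI) (auto simp: Cons.IH Let_def four_block_mat_def nth_Cons' simp del: One_nat_def)
qed (auto intro: eq_matI)

lemma diag_mat_mult_vec:
  fixes f :: "nat \<Rightarrow> 'k :: semiring_0"
  assumes "v \<in> carrier_vec n"
  shows "mat n n (\<lambda>(i, j). if i = j then f i else 0) *\<^sub>v v = vec n (\<lambda>i. f i * v $ i)"
proof (rule eq_vecI)
  fix i assume i: "i < dim_vec (vec n (\<lambda>i. f i * v $ i))"
  then have "(mat n n (\<lambda>(i, j). if i = j then f i else 0) *\<^sub>v v) $ i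
      = (\<Sum>j = 0..<n. (if i = j then f i else 0) * v $ j)"
    using assms by (auto simp: scalar_prod_def intro!: sum.cong)
  also have "\<dots> = (\<Sum>j = 0..<n. if i = j then f i * v $ i else 0)"
    by (intro sum.cong) auto
  finally show "(mat n n (\<lambda>(i, j). if i = j then f i else 0) *\<^sub>v v) $ i
      = vec n (\<lambda>i. f i * v $ i) $ i"
    using i by simp
qed simp

lemma diag_mat_mult:
  fixes f g :: "nat \<Rightarrow> 'k :: semiring_0"
  shows "mat n n (\<lambda>(i, j). if i = j then f i else 0) * mat n n (\<lambda>(i, j). if i = j then g i else 0)
    = mat n n (\<lambda>(i, j). if i = j then f i * g i else 0)"
proof (rule eq_matI)
  fix i j
  assume "i < dim_row (mat n n (\<lambda>(i, j). if i = j then f i * g i else 0))"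
    and "j < dim_col (mat n n (\<lambda>(i, j). if i = j then f i * g i else 0))"
  then have ij: "i < n" "j < n" by auto
  then have "(mat n n (\<lambda>(i, j). if i = j then f i else 0)
        * mat n n (\<lambda>(i, j). if i = j then g i else 0)) $$ (i, j)
      = (\<Sum>k = 0..<n. (if i = k then f i else 0) * (if k = j then g k else 0))"
    by (auto simp: scalar_prod_def intro!: sum.cong)
  also have "\<dots> = (\<Sum>k = 0..<n. if i = k then (if i = j then f i * g i else 0) else 0)"
    by (intro sum.cong) auto
  finally show "(mat n n (\<lambda>(i, j). if i = j then f i else 0)
        * mat n n (\<lambda>(i, j). if i = j then g i else 0)) $$ (i, j)
      = mat n n (\<lambda>(i, j). if i = j then f i * g i else 0) $$ (i, j)"
    using ij by simp
qed auto

section \<open>Irreducibility of the subset gliders and their separation by traces\<close>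

context self_dual_group
begin

lemma subset_glider_Length1:
  "xs \<noteq> [] \<Longrightarrow> subset_glider \<phi> xs t =
    Length1 (length xs)
      (\<lambda>h. mat (length xs) (length xs) (\<lambda>(i, j). if i = j then \<phi> (xs ! i) h else 0))
      (line (vec (length xs) (\<lambda>i. t (xs ! i))))"
  by (auto simp: subset_glider_def one_dim_rep_def diag_block_mat_one_dim vec_of_list_index
      simp del: One_nat_def vec_of_list_map intro!: arg_cong[of _ _ line] eq_vecI)

lemma generalized_trace_subset_glider:
  assumes "xs \<noteq> []" "distinct xs" "h \<in> carrier G"
  shows "generalized_trace G (subset_glider \<phi> xs t) (1, h) = Some (\<Sum>g\<in>set xs. \<phi> g h)"
proof -
  \<comment> \<open>Distinctness makes positions correspond bijectively to elements, so the trace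
    over positions is a sum over the set.\<close>
  have "(\<Sum>g\<in>set xs. \<phi> g h) = (\<Sum>j<length xs. \<phi> (xs ! j) h)"
    using assms(2) by (intro sum.reindex_bij_betw[symmetric] bij_betw_nth) auto
  with assms show ?thesis by (simp add: subset_glider_Length1)
qed

text \<open>Distinct characters let the group algebra act on the summands by independently chosen
  scalars; as no coordinate of the vector vanishes, every vector is reached.\<close>

lemma irreducible_subset_glider:
  assumes xs: "distinct xs" "set xs \<subseteq> carrier G"
    and t: "\<And>g. g \<in> set xs \<Longrightarrow> t g \<noteq> 0"
  shows "irreducible_glider G (subset_glider \<phi> xs t)"
proof (cases "xs = []")
  case True
  then show ?thesis by (simp add: subset_glider_def)
next
  case False
  define n where "n = length xs"
  define \<rho> where "\<rho> h = mat n n (\<lambda>(i, j). if i = j then \<phi> (xs ! i) h else 0)" for h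
  define m where "m = vec n (\<lambda>i. t (xs ! i))"
  have n: "n > 0" using False by (simp add: n_def)
  have xs_G: "xs ! i \<in> carrier G" if "i < n" for i
    using xs that by (auto simp: n_def)
  have t_nz: "t (xs ! i) \<noteq> 0" if "i < n" for i
    using t that by (auto simp: n_def)
  have rep: "matrix_rep G n \<rho>"
    unfolding matrix_rep_def \<rho>_def diag_mat_mult
    using xs_G by (auto simp: \<phi>_mult_right intro!: eq_matI)
  have m: "m \<in> carrier_vec n" by (simp add: m_def)
  have "m $ 0 \<noteq> 0" using n t_nz by (simp add: m_def)
  then have m0: "m \<noteq> 0\<^sub>v n" using n by auto
  have action: "\<rho> h *\<^sub>v m = vec n (\<lambda>i. \<phi> (xs ! i) h * t (xs ! i))" for h
    unfolding \<rho>_def diag_mat_mult_vec[OF m] by (auto simp: m_def intro!: eq_vecI)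
  \<comment> \<open>The group algebra element with coefficients \<open>c\<close> acts on the
    \<open>i\<close>-th summand as a scalar, the character sum on the right.\<close>
  have sum_index: "finsum_vec TYPE(complex) n (\<lambda>h. c h \<cdot>\<^sub>v (\<rho> h *\<^sub>v m)) (carrier G) $ i
      = t (xs ! i) * (\<Sum>h\<in>carrier G. c h * \<phi> (xs ! i) h)" if "i < n" for c i
    using that by (subst index_finsum_vec[OF fin]) (auto simp: action sum_distrib_left mult_ac)
  have sum_carrier: "finsum_vec TYPE(complex) n (\<lambda>h. c h \<cdot>\<^sub>v (\<rho> h *\<^sub>v m)) (carrier G) \<in> carrier_vec n"
    for c by (rule finsum_vec_closed) (auto simp: action)
  have "v \<in> cyclic_submodule G n \<rho> m" if v: "v \<in> carrier_vec n" for v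
  proof -
    \<comment> \<open>Orthogonality makes \<open>c\<close> act on the \<open>j\<close>-th summand as the scalar \<open>v\<^sub>j / t\<^sub>j\<close>.\<close>
    define c where "c h =
      (\<Sum>j<n. v $ j / (t (xs ! j) * of_nat (card (carrier G))) * inverse (\<phi> (xs ! j) h))" for h
    have "finsum_vec TYPE(complex) n (\<lambda>h. c h \<cdot>\<^sub>v (\<rho> h *\<^sub>v m)) (carrier G) = v"
    proof (rule eq_vecI)
      fix i assume "i < dim_vec v"
      then have i: "i < n" using v by simp
      have "(\<Sum>h\<in>carrier G. c h * \<phi> (xs ! i) h)
          = (\<Sum>j<n. \<Sum>h\<in>carrier G. v $ j / (t (xs ! j) * of_nat (card (carrier G)))
              * (\<phi> (xs ! i) h * inverse (\<phi> (xs ! j) h)))"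
        unfolding c_def sum_distrib_right by (subst sum.swap) (simp add: mult_ac)
      \<comment> \<open>Orthogonality leaves only \<open>j = i\<close>, where the order of
        \<open>G\<close> cancels; distinctness of \<open>xs\<close> turns equal elements into equal
        positions.\<close>
      also have "\<dots> = (\<Sum>j<n. if j = i then v $ i / t (xs ! i) else 0)"
        unfolding sum_distrib_left[symmetric]
        using i xs_G xs(1) card_carrier_nonzero
        by (intro sum.cong) (auto simp: \<phi>_orthogonal n_def nth_eq_iff_index_eq)
      also have "\<dots> = v $ i / t (xs ! i)" using i by simp
      finally show "finsum_vec TYPE(complex) n (\<lambda>h. c h \<cdot>\<^sub>v (\<rho> h *\<^sub>v m)) (carrier G) $ i = v $ i"
        using i t_nz by (simp add: sum_index)
    qed (use v sum_carrier[of c] in auto)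
    then show ?thesis unfolding cyclic_submodule_def by blast
  qed
  then have "carrier_vec n = cyclic_submodule G n \<rho> m"
    using sum_carrier by (auto simp: cyclic_submodule_def)
  with rep m m0 have "irreducible_glider G (Length1 n \<rho> (line m))"
    by auto
  with False show ?thesis by (simp add: subset_glider_Length1 n_def \<rho>_def[abs_def] m_def)
qed

text \<open>Equal generalized characters have equal traces, and for nonempty lists the level 1
  traces are character sums, which determine the subsets.\<close>

lemma subset_glider_gen_char_inject:
  assumes xs: "distinct xs" "set xs \<subseteq> carrier G" and ys: "distinct ys" "set ys \<subseteq> carrier G"
    and eq: "gen_char G (subset_glider \<phi> xs s) = gen_char G (subset_glider \<phi> ys t)"
  shows "set xs = set ys"
proof -
  have tr: "generalized_trace G (subset_glider \<phi> xs s) = generalized_trace G (subset_glider \<phi> ys t)"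
    using eq by (simp add: gen_char_def)
  \<comment> \<open>At level 1 the trace of \<open>Length0\<close> is undefined, whereas a nonempty
    list gives \<open>Some\<close> value; this separates the empty subset from all others.\<close>
  have empty: "generalized_trace G (subset_glider \<phi> [] u) (1, \<one>) = None" for u
    by (simp add: subset_glider_def)
  show ?thesis
  proof (cases "xs = [] \<or> ys = []")
    case True
    then show ?thesis
      using tr empty generalized_trace_subset_glider[OF _ xs(1) one_closed]
        generalized_trace_subset_glider[OF _ ys(1) one_closed]
      by (metis option.distinct(1))
  next
    case False
    then have "(\<Sum>g\<in>set xs. \<phi> g h) = (\<Sum>g\<in>set ys. \<phi> g h)" if "h \<in> carrier G" for h
      using tr generalized_trace_subset_glider[OF _ xs(1) that]
        generalized_trace_subset_glider[OF _ ys(1) that] by (metis option.inject)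
    with xs ys show ?thesis by (intro sum_\<phi>_inject)
  qed
qed

end

text \<open>\<open>enum\<close> and \<open>t\<close> choose, separately for each subset, an order of
  the summands and nonzero coordinates of the vector; every such choice is covered.\<close>

theorem theorem4p4:
  fixes G :: "('a, 'b) monoid_scheme"
    and \<phi> :: "'a \<Rightarrow> 'a \<Rightarrow> complex"
    and enum :: "'a set \<Rightarrow> 'a list"
    and t :: "'a set \<Rightarrow> 'a \<Rightarrow> complex"
  assumes "comm_group G" and "finite (carrier G)"
    and "\<phi> \<in> iso G (character_group G)"
    and "\<And>A. A \<subseteq> carrier G \<Longrightarrow> distinct (enum A) \<and> set (enum A) = A"
    and "\<And>A g. A \<subseteq> carrier G \<Longrightarrow> g \<in> A \<Longrightarrow> t A g \<noteq> 0"
  defines "\<chi> \<equiv> \<lambda>A. gen_char G (subset_glider \<phi> (enum A) (t A))"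
  shows "lin_indpt_family (class_ring :: complex ring) (complex_tensor (glider_rep_ring G))
           (\<lambda>A. pure_tensor (glider_rep_ring G) 1 (frag_of (\<chi> A))) (Pow (carrier G))"
proof -
  interpret self_dual_group G \<phi>
    using assms(1-3) by (simp add: self_dual_group_def self_dual_group_axioms_def)
  interpret R: comm_group "glider_rep_ring G"
    unfolding glider_rep_ring_def by (rule abelian_free_Abelian_group)
  have \<chi>_R: "frag_of (\<chi> A) \<in> carrier (glider_rep_ring G)" if "A \<in> Pow (carrier G)" for A
    using that assms(4,5) irreducible_subset_glider[of "enum A" "t A"]
    by (auto simp: glider_rep_ring_def \<chi>_def)
  have \<chi>_inj: "A = B" if "A \<in> Pow (carrier G)" "B \<in> Pow (carrier G)" "\<chi> A = \<chi> B" for A B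
    using that assms(4) subset_glider_gen_char_inject[of "enum A" "enum B" "t A" "t B"]
    by (auto simp: \<chi>_def)
  \<comment> \<open>\<open>L\<close> is to be the complex-linear extension of the integer coordinate
    at \<open>\<chi> A\<close>.\<close>
  have "\<exists>L. (\<forall>X\<in>carrier (complex_tensor (glider_rep_ring G)).
             \<forall>Y\<in>carrier (complex_tensor (glider_rep_ring G)).
               L (X \<oplus>\<^bsub>complex_tensor (glider_rep_ring G)\<^esub> Y) = L X + L Y)
      \<and> (\<forall>z. \<forall>X\<in>carrier (complex_tensor (glider_rep_ring G)).
               L (z \<odot>\<^bsub>complex_tensor (glider_rep_ring G)\<^esub> X) = z * L X)
      \<and> (\<forall>c. \<forall>x\<in>carrier (glider_rep_ring G).
               L (pure_tensor (glider_rep_ring G) c x)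
                 = c * of_int (Poly_Mapping.lookup x (\<chi> A)))" for A
  proof -
    have "of_int (Poly_Mapping.lookup (x \<otimes>\<^bsub>glider_rep_ring G\<^esub> y) (\<chi> A))
        = (of_int (Poly_Mapping.lookup x (\<chi> A)) + of_int (Poly_Mapping.lookup y (\<chi> A)) :: complex)"
      for x y by (simp add: glider_rep_ring_def lookup_add)
    from R.complex_tensor_functional[OF this] show ?thesis by metis
  qed
  then obtain L where L:
    "\<And>A X Y. \<lbrakk>X \<in> carrier (complex_tensor (glider_rep_ring G));
        Y \<in> carrier (complex_tensor (glider_rep_ring G))\<rbrakk> \<Longrightarrow>
      L A (X \<oplus>\<^bsub>complex_tensor (glider_rep_ring G)\<^esub> Y) = L A X + L A Y"
    "\<And>A z X. X \<in> carrier (complex_tensor (glider_rep_ring G)) \<Longrightarrow>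
      L A (z \<odot>\<^bsub>complex_tensor (glider_rep_ring G)\<^esub> X) = z * L A X"
    "\<And>A c x. x \<in> carrier (glider_rep_ring G) \<Longrightarrow>
      L A (pure_tensor (glider_rep_ring G) c x) = c * of_int (Poly_Mapping.lookup x (\<chi> A))"
    by metis
  show ?thesis
  proof (rule lin_indpt_familyI_dual[OF R.module_complex_tensor, where L = L])
    fix A B assume "A \<in> Pow (carrier G)" "B \<in> Pow (carrier G)"
    \<comment> \<open>The coordinate of the basis element \<open>\<chi> B\<close> at
      \<open>\<chi> A\<close> is 1 if the two agree and 0 otherwise; \<open>\<chi>_inj\<close> turns
      agreement into \<open>A = B\<close>.\<close>
    then show "L A (pure_tensor (glider_rep_ring G) 1 (frag_of (\<chi> B))) = (if A = B then 1 else 0)"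
      using \<chi>_inj[of A B] by (auto simp: L \<chi>_R)
  qed (simp_all add: L \<chi>_R R.pure_tensor_closed)
qed

end
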